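(* Let $\lambda>0$, let $(M,d)$ be a nonempty $\lambda$-hyperconvex metric space, let $G$ be a group, and let $\{T_a : a\in G\}$ be a uniformly $L$-Lipschitzian action of $G$ on $M$, where $0<L<\frac{\sqrt{2}}{\lambda}$. Suppose that all orbits $O(x)=\{T_a x : a\in G\}$, $x\in M$, are bounded. Then the set of common fixed points $\operatorname{Fix} G=\{x\in M : T_a x=x \text{ for all } a\in G\}$ is nonempty.
   Context: $B(x,r)=\{y\in M: d(x,y)\le r\}$ denotes a closed ball. A subset $D$ of a metric space $M$ is called admissible if it is an intersection of closed balls. A metric space $(M,d)$ is $\lambda$-hyperconvex if for every nonempty admissible set $D\subset M$ and for any family of closed balls $\{B(x_\alpha,r_\alpha)\}_{\alpha\in\Gamma}$ (with $r_\alpha\ge 0$) centered at points $x_\alpha\in D$, $\alpha\in\Gamma$, such that $d(x_\alpha,x_\beta)\le r_\alpha+r_\beta$ for all $\alpha,\beta\in\Gamma$, one has $D\cap\bigcap_{\alpha\in\Gamma}B(x_\alpha,\lambda r_\alpha)\neq\emptyset$. A group $G$ with identity $e$ acts on $M$ by maps $T_a:M\to M$, $a\in G$, if $T_a(T_b x)=T_{ab}x$ and $T_e x=x$ for all $a,b\in G$, $x\in M$. The action is uniformly $L$-Lipschitzian if $d(T_a x,T_a y)\le L\,d(x,y)$ for all $a\in G$ and $x,y\in M$ (the same constant $L$ for all $a$). *)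

theory Defs
  imports "HOL-Analysis.Abstract_Metric_Spaces" "HOL-Algebra.Group_Action"
begin

text \<open>Families of closed balls are represented by sets of pairs (centre, radius).  Every indexed
  family has such a set as its image, and the conditions below depend on that image only.\<close>

context Metric_space
begin

text \<open>The intersection is over a nonempty family, so that an unbounded \<open>M\<close> is not itself
  admissible.  Counting \<open>M\<close> as admissible would make hyperconvexity a possibly stronger property.\<close>

definition admissible :: "'a set \<Rightarrow> bool" where
  "admissible D \<longleftrightarrow>
     (\<exists>\<B>. \<B> \<noteq> {} \<and> \<B> \<subseteq> M \<times> {0..} \<and> D = (\<Inter>(x, r)\<in>\<B>. mcball x r))"

definition hyperconvex :: "real \<Rightarrow> bool" where
  "hyperconvex l \<longleftrightarrow>
     (\<forall>D \<B>. admissible D \<and> D \<noteq> {} \<and> \<B> \<subseteq> D \<times> {0..} \<and>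
        (\<forall>(x, r)\<in>\<B>. \<forall>(y, s)\<in>\<B>. d x y \<le> r + s) \<longrightarrow>
        D \<inter> (\<Inter>(x, r)\<in>\<B>. mcball x (l * r)) \<noteq> {})"

end

definition acts_on :: "('g, 'b) monoid_scheme \<Rightarrow> 'a set \<Rightarrow> ('g \<Rightarrow> 'a \<Rightarrow> 'a) \<Rightarrow> bool" where
  "acts_on G M T \<longleftrightarrow>
     (\<forall>a\<in>carrier G. T a \<in> M \<rightarrow> M) \<and>
     (\<forall>a\<in>carrier G. \<forall>b\<in>carrier G. \<forall>x\<in>M. T a (T b x) = T (a \<otimes>\<^bsub>G\<^esub> b) x) \<and>
     (\<forall>x\<in>M. T \<one>\<^bsub>G\<^esub> x = x)"

definition uniformly_lipschitzian ::
  "('g, 'b) monoid_scheme \<Rightarrow> 'a set \<Rightarrow> ('a \<Rightarrow> 'a \<Rightarrow> real) \<Rightarrow> real \<Rightarrow> ('g \<Rightarrow> 'a \<Rightarrow> 'a) \<Rightarrow> bool" where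
  "uniformly_lipschitzian G M d L T \<longleftrightarrow>
     (\<forall>a\<in>carrier G. \<forall>x\<in>M. \<forall>y\<in>M. d (T a x) (T a y) \<le> L * d x y)"

definition Fix :: "('g, 'b) monoid_scheme \<Rightarrow> 'a set \<Rightarrow> ('g \<Rightarrow> 'a \<Rightarrow> 'a) \<Rightarrow> 'a set" where
  "Fix G M T = {x \<in> M. \<forall>a\<in>carrier G. T a x = x}"

end

theory Submission imports Defs begin

text \<open>If every point of the orbit of \<open>x\<close> is within \<open>r\<close> of \<open>x\<close>, then the orbit has diameter at
  most \<open>L r\<close>, so hyperconvexity yields a point \<open>z\<close> of its admissible hull within \<open>l L r / 2\<close> of
  the whole orbit.  Each ball of radius \<open>l L\<^sup>2 r / 2\<close> around a point \<open>T\<^sub>a z\<close> contains the orbit of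
  \<open>x\<close>, hence also its hull, hence \<open>z\<close>.  So \<open>z\<close> is displaced by at most \<open>k r\<close> with
  \<open>k = l L\<^sup>2 / 2\<close>, and \<open>k < 1\<close> because \<open>l \<ge> 1\<close> in a space with more than one point.  Iterating gives
  a Cauchy sequence, and its limit is a common fixed point.\<close>

context Metric_space
begin

lemma admissible_mcball: "x \<in> M \<Longrightarrow> 0 \<le> r \<Longrightarrow> admissible (mcball x r)"
  unfolding admissible_def by (rule exI[of _ "{(x, r)}"]) auto

lemma hyperconvexD:
  assumes "hyperconvex l" "admissible D" "D \<noteq> {}" "\<B> \<subseteq> D \<times> {0..}"
    and "\<And>x r y s. (x, r) \<in> \<B> \<Longrightarrow> (y, s) \<in> \<B> \<Longrightarrow> d x y \<le> r + s"
  obtains z where "z \<in> D" "\<And>x r. (x, r) \<in> \<B> \<Longrightarrow> z \<in> mcball x (l * r)"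
proof -
  have "\<forall>(x, r)\<in>\<B>. \<forall>(y, s)\<in>\<B>. d x y \<le> r + s"
    using assms(5) by blast
  then have "D \<inter> (\<Inter>(x, r)\<in>\<B>. mcball x (l * r)) \<noteq> {}"
    using assms(1-4) unfolding hyperconvex_def by simp
  then show thesis using that by blast
qed

lemma hyperconvex_less_1_trivial:
  assumes "hyperconvex l" "l < 1" "x \<in> M" "y \<in> M"
  shows "x = y"
proof -
  \<comment> \<open>The centres must lie in an admissible set; this ball about \<open>x\<close> just
    reaches \<open>y\<close>.\<close>
  define D where "D = mcball x (d x y)"
  define \<B> where "\<B> = {(x, d x y / 2), (y, d x y / 2)}"
  have "admissible D" "D \<noteq> {}" "\<B> \<subseteq> D \<times> {0..}"
    using assms by (auto simp: D_def \<B>_def intro: admissible_mcball)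
  moreover have "d u v \<le> r + s" if "(u, r) \<in> \<B>" "(v, s) \<in> \<B>" for u r v s
  proof -
    have "r + s = d x y" "d u v = 0 \<or> d u v = d x y"
      using that assms(3,4) by (auto simp: \<B>_def commute)
    then show ?thesis using nonneg[of x y] by linarith
  qed
  ultimately obtain z where z: "\<And>u r. (u, r) \<in> \<B> \<Longrightarrow> z \<in> mcball u (l * r)"
    using hyperconvexD[OF assms(1), of D \<B>] by metis
  from z[of x "d x y / 2"] z[of y "d x y / 2"]
  have "z \<in> M" "d x z \<le> l * (d x y / 2)" "d y z \<le> l * (d x y / 2)"
    by (auto simp: \<B>_def)
  then have "d x y \<le> l * d x y"
    using triangle[of x z y] assms(3,4) by (simp add: commute)
  moreover have "l * d x y < d x y" if "0 < d x y"
    using that assms(2) by simp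
  ultimately show ?thesis
    using mdist_pos_eq[OF assms(3,4)] by linarith
qed

text \<open>Hyperconvexity stands in for completeness: balls about the \<open>x n\<close> whose
  radii bound the remaining path length satisfy the pairwise condition, and a common point of the
  scaled balls is the limit, since the radii tend to 0.\<close>

lemma hyperconvex_geometric_limit:
  fixes k C :: real
  assumes "hyperconvex l" and x: "\<And>n. x n \<in> M"
    and k: "0 \<le> k" "k < 1"
    and step: "\<And>n. d (x n) (x (Suc n)) \<le> C * k ^ n"
  obtains z where "z \<in> M" "\<And>n. d (x n) z \<le> l * (C / (1 - k) * k ^ n)"
proof -
  \<comment> \<open>The tail of the geometric series: the sum of \<open>C * k ^ i\<close> over
    \<open>i \<ge> n\<close>.\<close>
  define \<rho> where "\<rho> n = C / (1 - k) * k ^ n" for n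
  have "0 \<le> C"
    using order_trans[OF nonneg step[of 0]] by simp
  then have \<rho>_nonneg: "0 \<le> \<rho> n" for n
    using k by (simp add: \<rho>_def)
  have \<rho>_Suc: "\<rho> n = C * k ^ n + \<rho> (Suc n)" for n
    using k(2) by (simp add: \<rho>_def field_simps)
  have dist: "d (x n) (x (n + j)) \<le> \<rho> n" for n j
  \<comment> \<open>The first step of the path is split off, so the induction hypothesis is needed
    at \<open>Suc n\<close>.\<close>
  proof (induction j arbitrary: n)
    case 0
    then show ?case using x \<rho>_nonneg by simp
  next
    case (Suc j)
    have "d (x n) (x (n + Suc j)) \<le> d (x n) (x (Suc n)) + d (x (Suc n)) (x (Suc n + j))"
      using triangle x by simp
    then show ?case
      using step[of n] Suc[of "Suc n"] \<rho>_Suc[of n] by linarith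
  qed
  have dist': "d (x n) (x m) \<le> \<rho> n + \<rho> m" for n m
  proof (cases "n \<le> m")
    case True
    then show ?thesis using dist[of n "m - n"] \<rho>_nonneg[of m] by simp
  next
    case False
    then show ?thesis using dist[of m "n - m"] \<rho>_nonneg[of n] by (simp add: commute)
  qed
  let ?D = "mcball (x 0) (\<rho> 0)" and ?B = "range (\<lambda>n. (x n, \<rho> n))"
  have "admissible ?D" "x 0 \<in> ?D"
    using x \<rho>_nonneg admissible_mcball by auto
  moreover have "?B \<subseteq> ?D \<times> {0..}"
    using x \<rho>_nonneg dist[of 0] by auto
  ultimately obtain z where "z \<in> ?D" "\<And>u r. (u, r) \<in> ?B \<Longrightarrow> z \<in> mcball u (l * r)"
    using hyperconvexD[OF assms(1), of ?D ?B] dist' by blast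
  then have "z \<in> mcball (x n) (l * \<rho> n)" for n
    by blast
  then show thesis
    using that[of z] unfolding \<rho>_def by simp
qed

text \<open>One step of the iteration. The displacement bound \<open>r\<close> shrinks by the factor
  \<open>l * L\<^sup>2 / 2\<close>, while the bound on \<open>d x z\<close> keeps the iterates
  Cauchy.\<close>

lemma displacement_step:
  fixes G (structure)
  assumes hyp: "hyperconvex l" and "group G" and act: "acts_on G M T"
    and lip: "uniformly_lipschitzian G M d L T" and "0 < L" "0 < l"
    and x: "x \<in> M" and disp: "\<And>a. a \<in> carrier G \<Longrightarrow> d x (T a x) \<le> r"
  obtains z where "z \<in> M" "d x z \<le> l * L / 2 * r"
    "\<And>a. a \<in> carrier G \<Longrightarrow> d z (T a z) \<le> l * L\<^sup>2 / 2 * r"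
proof -
  interpret group G by fact
  have T_in: "T a y \<in> M" if "a \<in> carrier G" "y \<in> M" for a y
    using act that unfolding acts_on_def by blast
  have T_mult: "T a (T b y) = T (a \<otimes> b) y" if "a \<in> carrier G" "b \<in> carrier G" "y \<in> M" for a b y
    using act that unfolding acts_on_def by blast
  have T_one: "T \<one> y = y" if "y \<in> M" for y
    using act that unfolding acts_on_def by blast
  have lipD: "d (T a y) (T a z) \<le> L * d y z" if "a \<in> carrier G" "y \<in> M" "z \<in> M" for a y z
    using lip that unfolding uniformly_lipschitzian_def by blast
  \<comment> \<open>\<open>T a\<close> maps the orbit of \<open>x\<close> onto itself, so
    \<open>T b x\<close> is the image under \<open>T a\<close> of another orbit point.\<close>
  have shift: "d (T a y) (T b x) \<le> L * d y (T (inv a \<otimes> b) x)"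
    if "a \<in> carrier G" "b \<in> carrier G" "y \<in> M" for a b y
  proof -
    have "a \<otimes> (inv a \<otimes> b) = b"
      using that by (simp add: m_assoc[symmetric])
    then have "T b x = T a (T (inv a \<otimes> b) x)"
      using T_mult[of a "inv a \<otimes> b" x] that x by simp
    then show ?thesis
      using lipD[of a y "T (inv a \<otimes> b) x"] that x T_in by simp
  qed
  have "0 \<le> r"
    using disp[OF one_closed] nonneg order_trans by blast
  have diam: "d (T a x) (T b x) \<le> L * r" if "a \<in> carrier G" "b \<in> carrier G" for a b
  proof -
    have "L * d x (T (inv a \<otimes> b) x) \<le> L * r"
      using disp[of "inv a \<otimes> b"] that \<open>0 < L\<close> by (intro mult_left_mono) auto
    then show ?thesis
      using shift[OF that x] by linarith
  qed
  \<comment> \<open>All closed balls containing the orbit; their intersection \<open>D\<close> is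
    its admissible hull, so a point of \<open>D\<close> lies in every such ball.\<close>
  define \<C> where "\<C> = {(c, s). c \<in> M \<and> 0 \<le> s \<and> (\<forall>a\<in>carrier G. T a x \<in> mcball c s)}"
  define D where "D = (\<Inter>(c, s)\<in>\<C>. mcball c s)"
  \<comment> \<open>Half the diameter bound \<open>L * r\<close>, so that two radii add up to
    it.\<close>
  define \<B> where "\<B> = (\<lambda>a. (T a x, L * r / 2)) ` carrier G"
  have "(x, r) \<in> \<C>"
    using x disp T_in \<open>0 \<le> r\<close> by (auto simp: \<C>_def)
  then have "admissible D"
    unfolding admissible_def D_def by (intro exI[of _ \<C>]) (auto simp: \<C>_def)
  moreover have orbit_D: "T a x \<in> D" if "a \<in> carrier G" for a
    using that by (auto simp: D_def \<C>_def)
  moreover have "D \<noteq> {}"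
    using orbit_D[OF one_closed] by blast
  moreover have "\<B> \<subseteq> D \<times> {0..}"
    using orbit_D \<open>0 \<le> r\<close> \<open>0 < L\<close> by (auto simp: \<B>_def)
  moreover have "d u v \<le> s + t" if "(u, s) \<in> \<B>" "(v, t) \<in> \<B>" for u s v t
    using that diam by (auto simp: \<B>_def)
  ultimately obtain z where zD: "z \<in> D"
    and zB: "\<And>u s. (u, s) \<in> \<B> \<Longrightarrow> z \<in> mcball u (l * s)"
    using hyperconvexD[OF hyp, of D \<B>] by metis
  have z_near: "z \<in> M" "d (T a x) z \<le> l * L / 2 * r" if "a \<in> carrier G" for a
    using zB[of "T a x" "L * r / 2"] that by (auto simp: \<B>_def)
  have zM: "z \<in> M" using z_near one_closed by blast
  show thesis
  proof
    show "z \<in> M" by fact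
    show "d x z \<le> l * L / 2 * r"
      using z_near(2)[OF one_closed] T_one[OF x] by simp
    fix a assume a: "a \<in> carrier G"
    \<comment> \<open>Applying \<open>T a\<close> to the estimate between \<open>z\<close> and the
      orbit costs one more factor \<open>L\<close>.\<close>
    have "d (T a z) (T b x) \<le> l * L\<^sup>2 / 2 * r" if b: "b \<in> carrier G" for b
    proof -
      have "L * d z (T (inv a \<otimes> b) x) \<le> L * (l * L / 2 * r)"
        using z_near(2)[of "inv a \<otimes> b"] a b \<open>0 < L\<close>
        by (intro mult_left_mono) (auto simp: commute)
      then show ?thesis
        using shift[OF a b zM] by (simp add: power2_eq_square mult_ac)
    qed
    then have "(T a z, l * L\<^sup>2 / 2 * r) \<in> \<C>"
      using a zM x T_in \<open>0 \<le> r\<close> \<open>0 < l\<close> by (auto simp: \<C>_def)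
    then have "z \<in> mcball (T a z) (l * L\<^sup>2 / 2 * r)"
      using zD by (auto simp: D_def)
    then show "d z (T a z) \<le> l * L\<^sup>2 / 2 * r"
      by (simp add: commute)
  qed
qed

end

theorem theorem2p9:
  fixes M :: "'a set" and d :: "'a \<Rightarrow> 'a \<Rightarrow> real"
    and G :: "('g, 'b) monoid_scheme" and T :: "'g \<Rightarrow> 'a \<Rightarrow> 'a"
    and l L :: real
  assumes "l > 0"
    and "Metric_space M d" and "M \<noteq> {}"
    and "Metric_space.hyperconvex M d l"
    and "group G" and "acts_on G M T"
    and "uniformly_lipschitzian G M d L T"
    and "0 < L" and "L < sqrt 2 / l"
    and "\<And>x. x \<in> M \<Longrightarrow> Metric_space.mbounded M d (orbit G T x)"
  shows "Fix G M T \<noteq> {}"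
proof -
  interpret Metric_space M d by fact
  interpret group G by fact
  have T_in: "T a y \<in> M" if "a \<in> carrier G" "y \<in> M" for a y
    using assms(6) that unfolding acts_on_def by blast
  obtain x0 where x0: "x0 \<in> M" using assms(3) by blast
  show ?thesis
  proof (cases "l < 1")
    case True
    then have "T a x0 = x0" if "a \<in> carrier G" for a
      using hyperconvex_less_1_trivial[OF assms(4)] T_in[OF that x0] x0 by blast
    then show ?thesis
      using x0 unfolding Fix_def by blast
  next
    case False
    define k where "k = l * L\<^sup>2 / 2"
    have "L * l < sqrt 2"
      using assms(1,9) by (simp add: field_simps)
    then have "(L * l)\<^sup>2 < (sqrt 2)\<^sup>2"
      using assms(1,8) by (intro power_strict_mono) auto
    \<comment> \<open>Here \<open>1 \<le> l\<close> enters: it turns \<open>L * l < sqrt 2\<close>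
      into \<open>l * L\<^sup>2 < 2\<close>.\<close>
    moreover have "l * L\<^sup>2 \<le> (L * l)\<^sup>2"
      using False mult_right_mono[of 1 l "l * L\<^sup>2"] assms(1,8)
      by (simp add: power2_eq_square mult_ac)
    ultimately have k: "0 \<le> k" "k < 1"
      using assms(1) by (auto simp: k_def)
    obtain c B where "orbit G T x0 \<subseteq> mcball c B"
      using assms(10)[OF x0] unfolding mbounded_def by blast
    then have near: "c \<in> M" "d c (T a x0) \<le> B" if "a \<in> carrier G" for a
      using that unfolding orbit_def by auto
    \<comment> \<open>Boundedness gives a ball about an arbitrary \<open>c\<close>; the iteration
      needs a bound on distances from \<open>x0\<close> itself.\<close>
    define r where "r = d x0 c + B"
    have "d x0 (T a x0) \<le> r" if "a \<in> carrier G" for a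
      using triangle[of x0 c "T a x0"] near[OF that] T_in[OF that x0] x0 by (simp add: r_def)
    then have base: "\<exists>x. x \<in> M \<and> (\<forall>a\<in>carrier G. d x (T a x) \<le> k ^ 0 * r)"
      using x0 by auto
    have step: "\<exists>z. (z \<in> M \<and> (\<forall>a\<in>carrier G. d z (T a z) \<le> k ^ Suc n * r))
        \<and> d x z \<le> l * L / 2 * (k ^ n * r)"
      if x: "x \<in> M \<and> (\<forall>a\<in>carrier G. d x (T a x) \<le> k ^ n * r)" for x n
    proof -
      obtain z where "z \<in> M" "d x z \<le> l * L / 2 * (k ^ n * r)"
        "\<And>a. a \<in> carrier G \<Longrightarrow> d z (T a z) \<le> l * L\<^sup>2 / 2 * (k ^ n * r)"
        by (rule displacement_step[OF assms(4-8,1), of x "k ^ n * r"]) (use x in blast)+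
      then show ?thesis
        unfolding k_def[symmetric] by (auto simp: mult_ac)
    qed
    \<comment> \<open>Each iterate is chosen depending on the previous one, with displacement bound
      \<open>k ^ n * r\<close>.\<close>
    obtain x where x: "\<And>n. x n \<in> M"
      and disp: "\<And>n a. a \<in> carrier G \<Longrightarrow> d (x n) (T a (x n)) \<le> k ^ n * r"
      and move: "\<And>n. d (x n) (x (Suc n)) \<le> l * L / 2 * (k ^ n * r)"
      using dependent_nat_choice[of "\<lambda>n x. x \<in> M \<and> (\<forall>a\<in>carrier G. d x (T a x) \<le> k ^ n * r)"
          "\<lambda>n x z. d x z \<le> l * L / 2 * (k ^ n * r)", OF base step] by blast
    define C where "C = l * L / 2 * r"
    have move': "d (x n) (x (Suc n)) \<le> C * k ^ n" for n
      using move[of n] by (simp add: C_def mult_ac)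
    obtain z where z: "z \<in> M" "\<And>n. d (x n) z \<le> l * (C / (1 - k) * k ^ n)"
      by (rule hyperconvex_geometric_limit[OF assms(4) x k move']) blast
    have "T a z = z" if a: "a \<in> carrier G" for a
    proof -
      \<comment> \<open>The path from \<open>z\<close> to \<open>T a z\<close> through
        \<open>x n\<close> and \<open>T a (x n)\<close> costs \<open>1 + L\<close> times the
        distance from \<open>x n\<close> to \<open>z\<close>, plus the displacement of
        \<open>x n\<close>.\<close>
      define K where "K = (1 + L) * (l * (C / (1 - k))) + r"
      have "d z (T a z) \<le> K * k ^ n" for n
      proof -
        have "d z (T a z) \<le> d (x n) z + d (x n) (T a (x n)) + d (T a (x n)) (T a z)"
          using triangle[of z "x n" "T a z"] triangle[of "x n" "T a (x n)" "T a z"]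
            x z(1) T_in[OF a] by (simp add: commute)
        also have "d (T a (x n)) (T a z) \<le> L * d (x n) z"
          using assms(7) a x z(1) unfolding uniformly_lipschitzian_def by blast
        also have "d (x n) z + d (x n) (T a (x n)) + L * d (x n) z
            = (1 + L) * d (x n) z + d (x n) (T a (x n))"
          by (simp add: algebra_simps)
        also have "\<dots> \<le> (1 + L) * (l * (C / (1 - k) * k ^ n)) + k ^ n * r"
          using z(2) disp[OF a] assms(8) by (intro add_mono mult_left_mono) auto
        also have "\<dots> = K * k ^ n"
          by (simp add: K_def distrib_left distrib_right mult_ac)
        finally show ?thesis by simp
      qed
      moreover have "(\<lambda>n. K * k ^ n) \<longlonglongrightarrow> 0"
        using k by (intro tendsto_mult_right_zero LIMSEQ_realpow_zero)
      ultimately have "d z (T a z) \<le> 0"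
        by (intro LIMSEQ_le_const) auto
      then show ?thesis
        using mdist_pos_eq[OF z(1) T_in[OF a z(1)]] by auto
    qed
    then show ?thesis
      using z(1) unfolding Fix_def by blast
  qed
qed

end
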